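(* Let $R$ be a po-ring and let $A$ be a partially ordered right $R$-module. Then $A$ is po-coherent if and only if for all $k,m,n\in\mathbb{Z}^+$ and all $M\in\mathfrak{M}_{k,m}(A)$, $N\in\mathfrak{M}_{k,n}(A)$, the solution set of the system $$MX+NY\geq 0,\qquad X\geq 0,$$ with unknowns $X\in\mathfrak{M}_{m,1}(R)$ and $Y\in\mathfrak{M}_{n,1}(R)$, is a finitely generated right $R^+$-semimodule.
   Context: Rings are associative and unital; modules are unital right modules; $\mathbb{Z}^+=\{0,1,2,\dots\}$. A po-ring is a ring $R$ with a partial ordering $\leq$ such that: $x\leq y$ implies $x+z\leq y+z$, and, if $z\geq 0$, also $xz\leq yz$ and $zx\leq zy$; $R$ is directed, i.e. $R=R^++(-R^+)$ where $R^+=\{x\in R: x\geq 0\}$; and $0\leq 1$. A partially ordered right $R$-module is a right $R$-module $A$ with a partial ordering such that $x\leq y$ implies $x+z\leq y+z$ and, for $\lambda\in R^+$, $x\lambda\leq y\lambda$. A right $R^+$-(sub)semimodule is an additive (sub)monoid closed under right multiplication by scalars in $R^+$; it is finitely generated if it consists of all right linear combinations, with coefficients in $R^+$, of some finite subset of itself. For a set $S$, $\mathfrak{M}_{m,n}(S)$ is the set of $m\times n$ matrices with entries in $S$; matrices are ordered entrywise; a matrix over $A$ multiplied on the right by a matrix over $R$ gives a matrix over $A$. $A$ is po-coherent if for every integer $n\geq 1$ and every row matrix $U\in\mathfrak{M}_{1,n}(A)$, the set $\{X\in\mathfrak{M}_{n,1}(R): UX\geq 0\text{ and }X\geq 0\}$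 is a finitely generated right $R^+$-subsemimodule of $\mathfrak{M}_{n,1}(R)$. *)

theory Defs
  imports "Jordan_Normal_Form.Matrix"
begin

text \<open>The class \<^class>\<open>ring_1\<close> would exclude the trivial ring, so the unit comes from \<^class>\<open>monoid_mult\<close>.\<close>

class po_ring = ordered_ring + monoid_mult +
  assumes po_zero_le_one: "0 \<le> 1"
    and po_directed: "\<exists>y z. 0 \<le> y \<and> 0 \<le> z \<and> x = y + - z"

locale po_right_module =
  fixes act :: "'a::ordered_ab_group_add \<Rightarrow> 'r::po_ring \<Rightarrow> 'a"
  assumes act_add_left: "act (x + y) r = act x r + act y r"
    and act_add_right: "act x (r + s) = act x r + act x s"
    and act_mult: "act x (r * s) = act (act x r) s"
    and act_one: "act x 1 = x"
    and act_mono: "x \<le> y \<Longrightarrow> 0 \<le> r \<Longrightarrow> act x r \<le> act y r"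

text \<open>The next three definitions concern a subset \<open>S\<close> of an ambient right module given by its
  addition, zero and right action, so that they apply both to columns and to pairs of columns.
  A linear combination is a list of generators with attached coefficients; a generator that
  occurs repeatedly amounts to one occurrence with the coefficients added up.\<close>

definition right_subsemimodule ::
    "('v \<Rightarrow> 'v \<Rightarrow> 'v) \<Rightarrow> 'v \<Rightarrow> ('v \<Rightarrow> 'r::po_ring \<Rightarrow> 'v) \<Rightarrow> 'v set \<Rightarrow> bool" where
  "right_subsemimodule plus_op zero_op sc S \<longleftrightarrow>
     zero_op \<in> S \<and> (\<forall>x\<in>S. \<forall>y\<in>S. plus_op x y \<in> S) \<and> (\<forall>x\<in>S. \<forall>r. 0 \<le> r \<longrightarrow> sc x r \<in> S)"

definition right_lin_comb ::
    "('v \<Rightarrow> 'v \<Rightarrow> 'v) \<Rightarrow> 'v \<Rightarrow> ('v \<Rightarrow> 'r::po_ring \<Rightarrow> 'v) \<Rightarrow> ('v \<times> 'r) list \<Rightarrow> 'v" where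
  "right_lin_comb plus_op zero_op sc ps = foldr (\<lambda>(g, r) s. plus_op (sc g r) s) ps zero_op"

definition fin_gen_right_semimodule ::
    "('v \<Rightarrow> 'v \<Rightarrow> 'v) \<Rightarrow> 'v \<Rightarrow> ('v \<Rightarrow> 'r::po_ring \<Rightarrow> 'v) \<Rightarrow> 'v set \<Rightarrow> bool" where
  "fin_gen_right_semimodule plus_op zero_op sc S \<longleftrightarrow>
     right_subsemimodule plus_op zero_op sc S \<and>
     (\<exists>G. finite G \<and> G \<subseteq> S \<and>
          S = {right_lin_comb plus_op zero_op sc ps | ps. set ps \<subseteq> G \<times> {r. 0 \<le> r}})"

definition mat_rscale :: "'r::po_ring mat \<Rightarrow> 'r \<Rightarrow> 'r mat" where
  "mat_rscale X r = map_mat (\<lambda>x. x * r) X"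

definition mat_act ::
    "('a::ordered_ab_group_add \<Rightarrow> 'r::po_ring \<Rightarrow> 'a) \<Rightarrow> 'a mat \<Rightarrow> 'r mat \<Rightarrow> 'a mat" where
  "mat_act act M X =
     mat (dim_row M) (dim_col X) (\<lambda>(i, j). \<Sum>l<dim_row X. act (M $$ (i, l)) (X $$ (l, j)))"

text \<open>The order \<open>\<le>\<close> on matrices is the library's entrywise one.\<close>

definition po_coherent :: "('a::ordered_ab_group_add \<Rightarrow> 'r::po_ring \<Rightarrow> 'a) \<Rightarrow> bool" where
  "po_coherent act \<longleftrightarrow>
     (\<forall>n\<ge>1. \<forall>U\<in>carrier_mat 1 n.
        fin_gen_right_semimodule (+) (0\<^sub>m n 1) mat_rscale
          {X \<in> carrier_mat n 1. 0\<^sub>m 1 1 \<le> mat_act act U X \<and> 0\<^sub>m n 1 \<le> X})"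

text \<open>The solutions of \<open>MX + NY \<ge> 0\<close>, \<open>X \<ge> 0\<close> are pairs \<open>(X, Y)\<close>, with componentwise
  operations.\<close>

definition system_solutions ::
    "('a::ordered_ab_group_add \<Rightarrow> 'r::po_ring \<Rightarrow> 'a) \<Rightarrow> nat \<Rightarrow> nat \<Rightarrow> nat \<Rightarrow>
      'a mat \<Rightarrow> 'a mat \<Rightarrow> ('r mat \<times> 'r mat) set" where
  "system_solutions act k m n M N =
     {(X, Y). X \<in> carrier_mat m 1 \<and> Y \<in> carrier_mat n 1 \<and>
              0\<^sub>m k 1 \<le> mat_act act M X + mat_act act N Y \<and> 0\<^sub>m m 1 \<le> X}"

definition pair_add :: "'r::po_ring mat \<times> 'r mat \<Rightarrow> 'r mat \<times> 'r mat \<Rightarrow> 'r mat \<times> 'r mat" where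
  "pair_add p q = (fst p + fst q, snd p + snd q)"

definition pair_rscale :: "'r::po_ring mat \<times> 'r mat \<Rightarrow> 'r \<Rightarrow> 'r mat \<times> 'r mat" where
  "pair_rscale p r = (mat_rscale (fst p) r, mat_rscale (snd p) r)"

end

theory Submission
  imports Defs
begin

text \<open>Finite generation passes to images under additive, \<open>R\<^sup>+\<close>-equivariant maps, and everything
  reduces to this. The rows of a system are treated one at a time: if the columns of \<open>G\<close> generate the
  nonnegative solutions of the first \<open>k\<close> rows, then \<open>G\<close> maps the nonnegative solutions \<open>L\<close> of
  \<open>(U G) L \<ge> 0\<close> onto the nonnegative solutions of these rows together with the row \<open>U\<close>. By
  directedness each unrestricted unknown \<open>Y\<close> is a difference of two nonnegative ones.\<close>

section \<open>Linear combinations and images of finitely generated semimodules\<close>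

lemma right_lin_comb_Nil [simp]: "right_lin_comb plus_op zero_op sc [] = zero_op"
  by (simp add: right_lin_comb_def)

lemma right_lin_comb_Cons [simp]:
  "right_lin_comb plus_op zero_op sc ((g, r) # ps) =
     plus_op (sc g r) (right_lin_comb plus_op zero_op sc ps)"
  by (simp add: right_lin_comb_def)

lemma right_lin_comb_mem:
  assumes "right_subsemimodule plus_op zero_op sc S" "set ps \<subseteq> S \<times> {r. 0 \<le> r}"
  shows "right_lin_comb plus_op zero_op sc ps \<in> S"
  using assms(2)
proof (induction ps)
  case Nil
  then show ?case using assms(1) by (simp add: right_subsemimodule_def)
next
  case (Cons p ps)
  then show ?case using assms(1) by (cases p) (simp add: right_subsemimodule_def)
qed

text \<open>Since \<open>h\<close> respects the operations only on \<open>S\<close>, the induction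
  also needs every partial combination to stay in \<open>S\<close>. For matrices this matters:
  addition behaves well only between equal dimensions.\<close>

lemma right_lin_comb_image:
  assumes S: "right_subsemimodule plus1 zero1 sc1 S"
    and zero: "h zero1 = zero2"
    and plus: "\<And>x y. x \<in> S \<Longrightarrow> y \<in> S \<Longrightarrow> h (plus1 x y) = plus2 (h x) (h y)"
    and scale: "\<And>x r. x \<in> S \<Longrightarrow> 0 \<le> r \<Longrightarrow> h (sc1 x r) = sc2 (h x) r"
    and ps: "set ps \<subseteq> S \<times> {r. 0 \<le> r}"
  shows "h (right_lin_comb plus1 zero1 sc1 ps) =
    right_lin_comb plus2 zero2 sc2 (map (apfst h) ps)"
  using ps
proof (induction ps)
  case Nil
  then show ?case by (simp add: zero)
next
  case (Cons p ps)
  obtain g r where p: "p = (g, r)" by (cases p)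
  have g: "g \<in> S" "0 \<le> r" and ps: "set ps \<subseteq> S \<times> {r. 0 \<le> r}"
    using Cons.prems p by auto
  have "sc1 g r \<in> S" using S g by (simp add: right_subsemimodule_def)
  then show ?case
    using Cons.IH[OF ps] right_lin_comb_mem[OF S ps] g by (simp add: p plus scale)
qed

lemma fin_gen_right_semimodule_image:
  fixes sc1 :: "'v \<Rightarrow> 'r::po_ring \<Rightarrow> 'v"
  assumes fg: "fin_gen_right_semimodule plus1 zero1 sc1 S"
    and zero: "h zero1 = zero2"
    and plus: "\<And>x y. x \<in> S \<Longrightarrow> y \<in> S \<Longrightarrow> h (plus1 x y) = plus2 (h x) (h y)"
    and scale: "\<And>x r. x \<in> S \<Longrightarrow> 0 \<le> r \<Longrightarrow> h (sc1 x r) = sc2 (h x) r"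
  shows "fin_gen_right_semimodule plus2 zero2 sc2 (h ` S)"
proof -
  from fg obtain G where S: "right_subsemimodule plus1 zero1 sc1 S"
    and G: "finite G" "G \<subseteq> S"
    and gen: "S = {right_lin_comb plus1 zero1 sc1 ps | ps. set ps \<subseteq> G \<times> {r. 0 \<le> r}}"
    unfolding fin_gen_right_semimodule_def by blast
  have sub: "right_subsemimodule plus2 zero2 sc2 (h ` S)"
    unfolding right_subsemimodule_def
  proof (intro conjI ballI allI impI)
    show "zero2 \<in> h ` S"
      using S zero by (auto simp: right_subsemimodule_def)
  next
    fix x y assume "x \<in> h ` S" "y \<in> h ` S"
    then obtain x' y' where "x' \<in> S" "y' \<in> S" "x = h x'" "y = h y'" by blast
    moreover from this have "plus1 x' y' \<in> S"
      using S by (simp add: right_subsemimodule_def)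
    ultimately show "plus2 x y \<in> h ` S" by (metis plus imageI)
  next
    fix x and r :: 'r assume "x \<in> h ` S" and r: "0 \<le> r"
    then obtain x' where "x' \<in> S" "x = h x'" by blast
    moreover from this have "sc1 x' r \<in> S"
      using S r by (simp add: right_subsemimodule_def)
    ultimately show "sc2 x r \<in> h ` S" using r by (metis scale imageI)
  qed
  have "h ` S = {right_lin_comb plus2 zero2 sc2 ps | ps. set ps \<subseteq> h ` G \<times> {r. 0 \<le> r}}"
    (is "_ = ?T")
  proof (intro equalityI subsetI)
    fix y assume "y \<in> h ` S"
    then obtain ps where ps: "set ps \<subseteq> G \<times> {r. 0 \<le> r}"
      and y: "y = h (right_lin_comb plus1 zero1 sc1 ps)"
      using gen by blast
    have "y = right_lin_comb plus2 zero2 sc2 (map (apfst h) ps)"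
      unfolding y using S zero plus scale
      by (rule right_lin_comb_image) (use ps G in auto)
    moreover have "set (map (apfst h) ps) \<subseteq> h ` G \<times> {r. 0 \<le> r}" using ps by auto
    ultimately show "y \<in> ?T" by blast
  next
    fix y assume "y \<in> ?T"
    then obtain ps where "set ps \<subseteq> h ` G \<times> {r. 0 \<le> r}"
      and "y = right_lin_comb plus2 zero2 sc2 ps" by blast
    moreover from this have "set ps \<subseteq> h ` S \<times> {r. 0 \<le> r}" using G by blast
    ultimately show "y \<in> h ` S" using right_lin_comb_mem[OF sub] by blast
  qed
  with sub G show ?thesis unfolding fin_gen_right_semimodule_def by blast
qed

section \<open>Nonnegative matrices and the entries of products\<close>

text \<open>The order relates only matrices of equal dimensions, so nonnegativity carries the
  dimensions with it.\<close>

lemma zero_mat_le_iff: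
  "0\<^sub>m n m \<le> X \<longleftrightarrow> X \<in> carrier_mat n m \<and> (\<forall>i<n. \<forall>j<m. 0 \<le> X $$ (i, j))"
  by (auto simp: less_eq_mat_def)

lemma mat_rscale_carrier [simp]: "mat_rscale X r \<in> carrier_mat n m \<longleftrightarrow> X \<in> carrier_mat n m"
  by (simp add: mat_rscale_def)

lemma mat_act_carrier [simp]:
  "M \<in> carrier_mat k n \<Longrightarrow> X \<in> carrier_mat n m \<Longrightarrow> mat_act act M X \<in> carrier_mat k m"
  by (auto simp: mat_act_def)

lemma mat_act_index:
  assumes "M \<in> carrier_mat k n" "X \<in> carrier_mat n m" "i < k" "j < m"
  shows "mat_act act M X $$ (i, j) = (\<Sum>l<n. act (M $$ (i, l)) (X $$ (l, j)))"
  using assms by (auto simp: mat_act_def)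

lemma mat_act_col_index:
  assumes "M \<in> carrier_mat k n" "X \<in> carrier_mat n 1" "i < k"
  shows "mat_act act M X $$ (i, 0) = (\<Sum>l<n. act (M $$ (i, l)) (X $$ (l, 0)))"
  using assms by (simp add: mat_act_index[where m = 1])

text \<open>Gives ring products the same shape as \<open>mat_act_index\<close>, so that the two
  kinds of sums can be combined.\<close>

lemma times_mat_index_sum:
  assumes "G \<in> carrier_mat n p" "X \<in> carrier_mat p m" "i < n" "j < m"
  shows "(G * X) $$ (i, j) = (\<Sum>l<p. G $$ (i, l) * X $$ (l, j))"
  using assms by (auto simp: scalar_prod_def atLeast0LessThan intro!: sum.cong)

lemma times_col_index:
  assumes "G \<in> carrier_mat n p" "X \<in> carrier_mat p 1" "i < n"
  shows "(G * X) $$ (i, 0) = (\<Sum>l<p. G $$ (i, l) * X $$ (l, 0))"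
  using assms by (simp add: times_mat_index_sum[where m = 1] del: index_mult_mat)

text \<open>Scalars stand on the right, so associativity moves them past \<open>G\<close> without
  commutativity. This makes left multiplication by \<open>G\<close> equivariant.\<close>

lemma mat_rscale_times:
  fixes G X :: "'r::po_ring mat"
  assumes "G \<in> carrier_mat n p" "X \<in> carrier_mat p 1"
  shows "mat_rscale (G * X) r = G * mat_rscale X r"
proof (rule eq_matI)
  fix i j assume "i < dim_row (G * mat_rscale X r)" "j < dim_col (G * mat_rscale X r)"
  then have ij: "i < n" "j = 0" using assms by (auto simp: mat_rscale_def)
  have X: "mat_rscale X r \<in> carrier_mat p 1" using assms by simp
  have GX: "G * X \<in> carrier_mat n 1" using assms by simp
  have "mat_rscale (G * X) r $$ (i, j) = (\<Sum>l<p. G $$ (i, l) * X $$ (l, 0)) * r"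
    unfolding ij(2) times_col_index[OF assms ij(1), symmetric]
    using carrier_matD[OF GX] ij(1) by (simp add: mat_rscale_def del: index_mult_mat)
  also have "\<dots> = (G * mat_rscale X r) $$ (i, j)"
    unfolding ij(2) times_col_index[OF assms(1) X ij(1)]
    using assms ij by (auto simp: mat_rscale_def sum_distrib_right mult.assoc intro!: sum.cong)
  finally show "mat_rscale (G * X) r $$ (i, j) = (G * mat_rscale X r) $$ (i, j)" .
qed (use assms in \<open>auto simp: mat_rscale_def\<close>)

section \<open>Generating sets as matrices\<close>

text \<open>With the generators as columns of \<open>G\<close>, a linear combination is a product
  \<open>G * L\<close>, where \<open>L\<close> is the column of coefficients. A condition on members
  of \<open>S\<close> thus becomes a condition on \<open>L\<close>.\<close>

lemma fin_gen_obtain_generating_matrix: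
  fixes S :: "'r::po_ring mat set"
  assumes fg: "fin_gen_right_semimodule (+) (0\<^sub>m n 1) mat_rscale S"
    and sub: "S \<subseteq> carrier_mat n 1"
  obtains p G where "G \<in> carrier_mat n p" "S = (\<lambda>L. G * L) ` {L. 0\<^sub>m p 1 \<le> L}"
proof -
  from fg obtain B where S: "right_subsemimodule (+) (0\<^sub>m n 1) mat_rscale S"
    and B: "finite B" "B \<subseteq> S"
    and gen: "S = {right_lin_comb (+) (0\<^sub>m n 1) mat_rscale ps | ps. set ps \<subseteq> B \<times> {r. 0 \<le> r}}"
    unfolding fin_gen_right_semimodule_def by blast
  obtain xs where xs: "set xs = B" using finite_list[OF B(1)] by blast
  define p where "p = length xs"
  define G where "G = mat n p (\<lambda>(i, j). xs ! j $$ (i, 0))"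
  have G: "G \<in> carrier_mat n p" by (simp add: G_def)
  \<comment> \<open>The coefficient column is built along the list; coefficients of a repeated
    generator add up.\<close>
  have comb: "\<exists>L. 0\<^sub>m p 1 \<le> L \<and> right_lin_comb (+) (0\<^sub>m n 1) mat_rscale ps = G * L"
    if "set ps \<subseteq> B \<times> {r. 0 \<le> r}" for ps
    using that
  proof (induction ps)
    case Nil
    have "0\<^sub>m p 1 \<le> (0\<^sub>m p 1 :: 'r mat)" by (simp add: zero_mat_le_iff)
    moreover have "G * 0\<^sub>m p 1 = 0\<^sub>m n 1" using G by simp
    ultimately show ?case by (metis right_lin_comb_Nil)
  next
    case (Cons q ps)
    obtain g r where q: "q = (g, r)" by (cases q)
    have g: "g \<in> B" "0 \<le> r" using Cons.prems q by auto
    from Cons obtain L where L: "0\<^sub>m p 1 \<le> L"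
      and eq: "right_lin_comb (+) (0\<^sub>m n 1) mat_rscale ps = G * L" by auto
    have Lc: "L \<in> carrier_mat p 1" using L by (simp add: zero_mat_le_iff)
    obtain j where j: "j < p" "g = xs ! j" using g xs by (auto simp: in_set_conv_nth p_def)
    have gc: "g \<in> carrier_mat n 1" using g B sub by auto
    \<comment> \<open>\<open>E\<close> is the \<open>j\<close>-th unit column times
      \<open>r\<close>, so \<open>G * E\<close> is the \<open>j\<close>-th generator times
      \<open>r\<close>.\<close>
    define E where "E = mat p 1 (\<lambda>(i, _). if i = j then r else 0)"
    have E: "0\<^sub>m p 1 \<le> E" and Ec: "E \<in> carrier_mat p 1"
      using g by (auto simp: zero_mat_le_iff E_def)
    have "mat_rscale g r = G * E"
    proof (rule eq_matI)
      fix i c assume "i < dim_row (G * E)" "c < dim_col (G * E)"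
      then have i: "i < n" "c = 0" using G Ec by auto
      have "(G * E) $$ (i, c) = (\<Sum>l<p. if l = j then G $$ (i, l) * r else 0)"
        unfolding i(2) times_col_index[OF G Ec i(1)]
        by (rule sum.cong) (auto simp: E_def)
      also have "\<dots> = mat_rscale g r $$ (i, c)"
        using i j gc by (simp add: G_def mat_rscale_def)
      finally show "mat_rscale g r $$ (i, c) = (G * E) $$ (i, c)" by simp
    qed (use gc G Ec in \<open>auto simp: mat_rscale_def\<close>)
    then have "right_lin_comb (+) (0\<^sub>m n 1) mat_rscale (q # ps) = G * (E + L)"
      using eq mult_add_distrib_mat[OF G Ec Lc] by (simp add: q)
    moreover have "0\<^sub>m p 1 \<le> E + L" using E L by (auto simp: zero_mat_le_iff)
    ultimately show ?case by blast
  qed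
  have mem: "G * L \<in> S" if L: "0\<^sub>m p 1 \<le> L" for L
  proof -
    have Lc: "L \<in> carrier_mat p 1" using L by (simp add: zero_mat_le_iff)
    \<comment> \<open>The columns of \<open>G\<close> are added one at a time, each partial sum
      staying in \<open>S\<close> by closure. The empty sum is the zero column, which also covers
      \<open>p = 0\<close>.\<close>
    have part: "mat n 1 (\<lambda>(i, _). \<Sum>j<q. G $$ (i, j) * L $$ (j, 0)) \<in> S" if "q \<le> p" for q
      using that
    proof (induction q)
      case 0
      have "mat n 1 (\<lambda>(i, _). \<Sum>j<0. G $$ (i, j) * L $$ (j, 0)) = 0\<^sub>m n 1"
        by (rule eq_matI) auto
      then show ?case using S unfolding right_subsemimodule_def by metis
    next
      case (Suc q)
      have x: "xs ! q \<in> S" using Suc.prems xs B by (auto simp: p_def)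
      then have xc: "xs ! q \<in> carrier_mat n 1" using sub by auto
      have "mat_rscale (xs ! q) (L $$ (q, 0)) \<in> S"
        using S x L Suc.prems by (auto simp: right_subsemimodule_def zero_mat_le_iff)
      then have "mat n 1 (\<lambda>(i, _). \<Sum>j<q. G $$ (i, j) * L $$ (j, 0)) +
          mat_rscale (xs ! q) (L $$ (q, 0)) \<in> S"
        using Suc S by (auto simp: right_subsemimodule_def)
      also have "mat n 1 (\<lambda>(i, _). \<Sum>j<q. G $$ (i, j) * L $$ (j, 0)) +
          mat_rscale (xs ! q) (L $$ (q, 0)) =
          mat n 1 (\<lambda>(i, _). \<Sum>j<Suc q. G $$ (i, j) * L $$ (j, 0))"
        by (rule eq_matI) (use xc Suc.prems in \<open>auto simp: mat_rscale_def G_def\<close>)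
      finally show ?case .
    qed
    have "G * L = mat n 1 (\<lambda>(i, _). \<Sum>j<p. G $$ (i, j) * L $$ (j, 0))"
      by (rule eq_matI) (use G Lc times_col_index[OF G Lc] in auto)
    then show ?thesis using part[of p] by simp
  qed
  have "S = (\<lambda>L. G * L) ` {L. 0\<^sub>m p 1 \<le> L}"
  proof (intro equalityI subsetI)
    fix x assume "x \<in> S"
    then obtain ps where "set ps \<subseteq> B \<times> {r. 0 \<le> r}"
      "x = right_lin_comb (+) (0\<^sub>m n 1) mat_rscale ps" using gen by blast
    then show "x \<in> (\<lambda>L. G * L) ` {L. 0\<^sub>m p 1 \<le> L}" using comb by blast
  qed (use mem in auto)
  with G show ?thesis by (rule that)
qed

section \<open>Sums and the action on matrices over the module\<close>

lemma sum_lessThan_add: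
  fixes f :: "nat \<Rightarrow> 'b::comm_monoid_add"
  shows "(\<Sum>j<m + n. f j) = (\<Sum>j<m. f j) + (\<Sum>j<n. f (m + j))"
  by (induction n) (auto simp: add.assoc)

context po_right_module
begin

lemma act_zero_left [simp]: "act 0 r = 0"
  using act_add_left[of 0 0 r] by simp

lemma act_zero_right [simp]: "act x 0 = 0"
  using act_add_right[of x 0 0] by simp

lemma act_minus_left: "act (- x) r = - act x r"
  using act_add_left[of x "- x" r] by (simp add: eq_neg_iff_add_eq_0 add.commute)

lemma act_diff_right: "act x (r - s) = act x r - act x s"
  using act_add_right[of x "r - s" s] by (simp add: eq_diff_eq)

lemma act_sum_left: "act (\<Sum>i\<in>I. f i) r = (\<Sum>i\<in>I. act (f i) r)"
  by (induction I rule: infinite_finite_induct) (auto simp: act_add_left)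

lemma act_sum_right: "act x (\<Sum>i\<in>I. f i) = (\<Sum>i\<in>I. act x (f i))"
  by (induction I rule: infinite_finite_induct) (auto simp: act_add_right)

text \<open>Both sides are the same double sum, by \<open>act_mult\<close> and an exchange of
  summation. It turns a row condition on \<open>G * L\<close> into one on \<open>L\<close>, whose
  row is again over the module, so that coherence applies to it.\<close>

lemma mat_act_assoc:
  assumes U: "U \<in> carrier_mat k n" and G: "G \<in> carrier_mat n p" and L: "L \<in> carrier_mat p m"
  shows "mat_act act U (G * L) = mat_act act (mat_act act U G) L"
proof (rule eq_matI)
  fix i c assume "i < dim_row (mat_act act (mat_act act U G) L)"
    "c < dim_col (mat_act act (mat_act act U G) L)"
  then have i: "i < k" "c < m" using U L by (auto simp: mat_act_def)
  have GL: "G * L \<in> carrier_mat n m" using G L by simp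
  have UG: "mat_act act U G \<in> carrier_mat k p" using U G by simp
  have "mat_act act U (G * L) $$ (i, c) =
      (\<Sum>l<n. \<Sum>j<p. act (act (U $$ (i, l)) (G $$ (l, j))) (L $$ (j, c)))"
    unfolding mat_act_index[OF U GL i]
    by (rule sum.cong)
      (simp_all add: times_mat_index_sum[OF G L] i act_sum_right act_mult del: index_mult_mat)
  also have "\<dots> = (\<Sum>j<p. \<Sum>l<n. act (act (U $$ (i, l)) (G $$ (l, j))) (L $$ (j, c)))"
    by (rule sum.swap)
  also have "\<dots> = mat_act act (mat_act act U G) L $$ (i, c)"
    unfolding mat_act_index[OF UG L i]
    by (rule sum.cong) (simp_all add: mat_act_index[OF U G] i act_sum_left)
  finally show "mat_act act U (G * L) $$ (i, c) = mat_act act (mat_act act U G) L $$ (i, c)" .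
qed (use assms in \<open>auto simp: mat_act_def\<close>)

section \<open>Nonnegative solutions of systems of inequalities\<close>

text \<open>Coherence speaks of \<open>n \<ge> 1\<close> only. The case \<open>n = 0\<close> is
  added because the row reduction applies this with \<open>n\<close> the number of generators, which
  may be 0.\<close>

lemma nonneg_row_solutions_fin_gen:
  assumes coh: "po_coherent act" and U: "U \<in> carrier_mat 1 n"
  shows "fin_gen_right_semimodule (+) (0\<^sub>m n 1) mat_rscale
    {X. 0\<^sub>m 1 1 \<le> mat_act act U X \<and> 0\<^sub>m n 1 \<le> X}"
proof (cases "n = 0")
  case False
  have "{X \<in> carrier_mat n 1. 0\<^sub>m 1 1 \<le> mat_act act U X \<and> 0\<^sub>m n 1 \<le> X} =
      {X. 0\<^sub>m 1 1 \<le> mat_act act U X \<and> 0\<^sub>m n 1 \<le> X}"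
    by (auto simp: zero_mat_le_iff)
  moreover have "1 \<le> n" using False by simp
  ultimately show ?thesis using coh[unfolded po_coherent_def, rule_format, of n U] U by simp
next
  case True
  have "mat_act act U X = 0\<^sub>m 1 1" if "X \<in> carrier_mat 0 1" for X
    by (rule eq_matI) (use U that in \<open>auto simp: mat_act_def\<close>)
  moreover have "X = 0\<^sub>m 0 1" if "X \<in> carrier_mat 0 1" for X :: "'r mat"
    by (rule eq_matI) (use that in auto)
  ultimately have "{X. 0\<^sub>m 1 1 \<le> mat_act act U X \<and> 0\<^sub>m n 1 \<le> X} = {0\<^sub>m 0 1}"
    using True by (auto simp: zero_mat_le_iff)
  moreover have "fin_gen_right_semimodule (+) (0\<^sub>m 0 1) mat_rscale {0\<^sub>m 0 1 :: 'r mat}"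
  proof -
    have "mat_rscale (0\<^sub>m 0 1) r = 0\<^sub>m 0 1" for r :: 'r
      by (rule eq_matI) (auto simp: mat_rscale_def)
    then have "right_subsemimodule (+) (0\<^sub>m 0 1) mat_rscale {0\<^sub>m 0 1 :: 'r mat}"
      by (simp add: right_subsemimodule_def)
    \<comment> \<open>The empty set generates: the only list over it is \<open>[]\<close>, whose
      combination is zero.\<close>
    moreover have "{0\<^sub>m 0 1 :: 'r mat} =
        {right_lin_comb (+) (0\<^sub>m 0 1) mat_rscale ps | ps. set ps \<subseteq> {} \<times> {r. 0 \<le> r}}"
      by simp
    ultimately show ?thesis unfolding fin_gen_right_semimodule_def by blast
  qed
  ultimately show ?thesis using True by simp
qed

lemma nonneg_solutions_fin_gen:
  assumes coh: "po_coherent act" and "M \<in> carrier_mat k n"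
  shows "fin_gen_right_semimodule (+) (0\<^sub>m n 1) mat_rscale
    {X. 0\<^sub>m k 1 \<le> mat_act act M X \<and> 0\<^sub>m n 1 \<le> X}"
  using assms(2)
proof (induction k arbitrary: M)
  case 0
  \<comment> \<open>No rows impose the same condition as a single zero row, namely none beyond
    \<open>X \<ge> 0\<close>; hence coherence for the zero row settles the base case.\<close>
  have "0\<^sub>m 1 1 \<le> mat_act act (0\<^sub>m 1 n) X \<longleftrightarrow> 0\<^sub>m 0 1 \<le> mat_act act M X" if "0\<^sub>m n 1 \<le> X" for X
  proof -
    have X: "X \<in> carrier_mat n 1" using that by (simp add: zero_mat_le_iff)
    have "mat_act act (0\<^sub>m 1 n) X \<in> carrier_mat 1 1" "mat_act act M X \<in> carrier_mat 0 1"
      using mat_act_carrier[OF zero_carrier_mat X] mat_act_carrier[OF 0 X] by blast+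
    then show ?thesis
      using mat_act_col_index[OF zero_carrier_mat X, of 0 1 act] by (auto simp: zero_mat_le_iff)
  qed
  then have "{X. 0\<^sub>m 1 1 \<le> mat_act act (0\<^sub>m 1 n) X \<and> 0\<^sub>m n 1 \<le> X} =
      {X. 0\<^sub>m 0 1 \<le> mat_act act M X \<and> 0\<^sub>m n 1 \<le> X}" by blast
  then show ?case using nonneg_row_solutions_fin_gen[OF coh zero_carrier_mat] by metis
next
  case (Suc k)
  \<comment> \<open>\<open>M'\<close> keeps the first \<open>k\<close> rows, and \<open>U\<close> is
    the last one, of index \<open>k\<close>.\<close>
  define M' where "M' = mat k n (\<lambda>(i, j). M $$ (i, j))"
  define U where "U = mat 1 n (\<lambda>(_, j). M $$ (k, j))"
  have M': "M' \<in> carrier_mat k n" and U: "U \<in> carrier_mat 1 n"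
    by (auto simp: M'_def U_def)
  have split: "0\<^sub>m (Suc k) 1 \<le> mat_act act M X \<longleftrightarrow>
      0\<^sub>m k 1 \<le> mat_act act M' X \<and> 0\<^sub>m 1 1 \<le> mat_act act U X"
    if X: "X \<in> carrier_mat n 1" for X
  proof -
    have "mat_act act M X $$ (i, 0) = mat_act act M' X $$ (i, 0)" if "i < k" for i
      using that mat_act_col_index[OF Suc.prems X, of i act] mat_act_col_index[OF M' X, of i act]
      by (simp add: M'_def)
    moreover have "mat_act act M X $$ (k, 0) = mat_act act U X $$ (0, 0)"
      using mat_act_col_index[OF Suc.prems X, of k act] mat_act_col_index[OF U X, of 0 act]
      by (simp add: U_def)
    moreover have "mat_act act M X \<in> carrier_mat (Suc k) 1" "mat_act act M' X \<in> carrier_mat k 1"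
      "mat_act act U X \<in> carrier_mat 1 1"
      using X Suc.prems M' U by auto
    ultimately show ?thesis unfolding zero_mat_le_iff by (auto simp: less_Suc_eq)
  qed
  let ?S = "{X. 0\<^sub>m k 1 \<le> mat_act act M' X \<and> 0\<^sub>m n 1 \<le> X}"
  have "?S \<subseteq> carrier_mat n 1" by (auto simp: zero_mat_le_iff)
  with Suc.IH[OF M'] obtain p G where G: "G \<in> carrier_mat n p"
    and S: "?S = (\<lambda>L. G * L) ` {L. 0\<^sub>m p 1 \<le> L}"
    by (rule fin_gen_obtain_generating_matrix)
  let ?V = "mat_act act U G"
  let ?T = "{L. 0\<^sub>m 1 1 \<le> mat_act act ?V L \<and> 0\<^sub>m p 1 \<le> L}"
  have T: "L \<in> carrier_mat p 1" if "L \<in> ?T" for L using that by (simp add: zero_mat_le_iff)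
  have "fin_gen_right_semimodule (+) (0\<^sub>m p 1) mat_rscale ?T"
    using coh by (rule nonneg_row_solutions_fin_gen) (use U G in simp)
  then have "fin_gen_right_semimodule (+) (0\<^sub>m n 1) mat_rscale ((\<lambda>L. G * L) ` ?T)"
  proof (rule fin_gen_right_semimodule_image)
    show "G * 0\<^sub>m p 1 = 0\<^sub>m n 1" using G by simp
    show "G * (L + K) = G * L + G * K" if "L \<in> ?T" "K \<in> ?T" for L K
      using G T[OF that(1)] T[OF that(2)] by (rule mult_add_distrib_mat)
    show "G * mat_rscale L r = mat_rscale (G * L) r" if "L \<in> ?T" for L r
      using mat_rscale_times[OF G T[OF that]] by simp
  qed
  also have "(\<lambda>L. G * L) ` ?T = {X. 0\<^sub>m (Suc k) 1 \<le> mat_act act M X \<and> 0\<^sub>m n 1 \<le> X}"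
  proof -
    \<comment> \<open>By associativity the new condition depends on \<open>L\<close> only through
      \<open>G * L\<close>. So restricting \<open>L\<close> and then mapping gives exactly the part
      of \<open>?S\<close> on which the condition holds; injectivity of the map is not at
      issue.\<close>
    have "(\<lambda>L. G * L) ` ?T = (\<lambda>L. G * L) ` {L. 0\<^sub>m p 1 \<le> L \<and> 0\<^sub>m 1 1 \<le> mat_act act U (G * L)}"
    proof (rule arg_cong[where f = "image _"], rule Collect_cong)
      fix L
      show "0\<^sub>m 1 1 \<le> mat_act act ?V L \<and> 0\<^sub>m p 1 \<le> L \<longleftrightarrow>
          0\<^sub>m p 1 \<le> L \<and> 0\<^sub>m 1 1 \<le> mat_act act U (G * L)"
        using mat_act_assoc[OF U G, of L 1] by (auto simp: zero_mat_le_iff[of p])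
    qed
    also have "\<dots> = {X \<in> ?S. 0\<^sub>m 1 1 \<le> mat_act act U X}"
      unfolding S by blast
    also have "\<dots> = {X. 0\<^sub>m (Suc k) 1 \<le> mat_act act M X \<and> 0\<^sub>m n 1 \<le> X}"
      using split by (auto simp: zero_mat_le_iff[of n])
    finally show ?thesis .
  qed
  finally show ?case .
qed

section \<open>Systems with unrestricted unknowns\<close>

lemma system_solutions_fin_gen:
  assumes coh: "po_coherent act" and M: "M \<in> carrier_mat k m" and N: "N \<in> carrier_mat k n"
  shows "fin_gen_right_semimodule pair_add (0\<^sub>m m 1, 0\<^sub>m n 1) pair_rscale
    (system_solutions act k m n M N)"
proof -
  let ?q = "m + n + n"
  \<comment> \<open>\<open>P\<close> is the block matrix \<open>(M | N | -N)\<close>, acting on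
    columns that stack \<open>X\<close> and two nonnegative columns whose difference is
    \<open>Y\<close>.\<close>
  define P where "P = mat k ?q (\<lambda>(i, j). if j < m then M $$ (i, j)
    else if j < m + n then N $$ (i, j - m) else - N $$ (i, j - (m + n)))"
  \<comment> \<open>\<open>h1\<close> and \<open>h2\<close> recover \<open>X\<close> and
    \<open>Y\<close> from the stacked column.\<close>
  define h1 where "h1 = (\<lambda>Z :: 'r mat. mat m 1 (\<lambda>(i, _). Z $$ (i, 0)))"
  define h2 where
    "h2 = (\<lambda>Z :: 'r mat. mat n 1 (\<lambda>(i, _). Z $$ (m + i, 0) - Z $$ (m + n + i, 0)))"
  have h: "h1 Z \<in> carrier_mat m 1" "h2 Z \<in> carrier_mat n 1" for Z
    by (auto simp: h1_def h2_def)
  have P: "P \<in> carrier_mat k ?q" by (simp add: P_def)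
  have PZ: "mat_act act P Z = mat_act act M (h1 Z) + mat_act act N (h2 Z)"
    if Z: "Z \<in> carrier_mat ?q 1" for Z
  proof (rule eq_matI)
    have c: "mat_act act M (h1 Z) \<in> carrier_mat k 1" "mat_act act N (h2 Z) \<in> carrier_mat k 1"
      using M N h by auto
    fix i j assume "i < dim_row (mat_act act M (h1 Z) + mat_act act N (h2 Z))"
      "j < dim_col (mat_act act M (h1 Z) + mat_act act N (h2 Z))"
    then have i: "i < k" "j = 0" using c by auto
    \<comment> \<open>The sum over \<open>m + n + n\<close> is split twice, into the three blocks;
      the last two merge because \<open>act\<close> is additive in both arguments.\<close>
    have "mat_act act P Z $$ (i, 0) = (\<Sum>l<m. act (M $$ (i, l)) (Z $$ (l, 0))) +
        (\<Sum>l<n. act (N $$ (i, l)) (Z $$ (m + l, 0) - Z $$ (m + n + l, 0)))"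
      unfolding mat_act_col_index[OF P Z i(1)] sum_lessThan_add
      using i by (simp add: P_def act_diff_right act_minus_left sum_subtractf sum_negf)
    also have "\<dots> = mat_act act M (h1 Z) $$ (i, 0) + mat_act act N (h2 Z) $$ (i, 0)"
      unfolding mat_act_col_index[OF M h(1) i(1)]
        mat_act_col_index[OF N h(2) i(1)]
      by (simp add: h1_def h2_def)
    finally show "mat_act act P Z $$ (i, j) =
        (mat_act act M (h1 Z) + mat_act act N (h2 Z)) $$ (i, j)"
      using c i by simp
  qed (use N Z h in \<open>auto simp: mat_act_def P_def h2_def\<close>)
  let ?T = "{Z. 0\<^sub>m k 1 \<le> mat_act act P Z \<and> 0\<^sub>m ?q 1 \<le> Z}"
  have T: "Z \<in> carrier_mat ?q 1" if "Z \<in> ?T" for Z using that by (simp add: zero_mat_le_iff)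
  have "fin_gen_right_semimodule pair_add (0\<^sub>m m 1, 0\<^sub>m n 1) pair_rscale
      ((\<lambda>Z. (h1 Z, h2 Z)) ` ?T)"
  proof (rule fin_gen_right_semimodule_image[OF nonneg_solutions_fin_gen[OF coh P]])
    show "(h1 (0\<^sub>m ?q 1), h2 (0\<^sub>m ?q 1)) = (0\<^sub>m m 1, 0\<^sub>m n 1)"
      by (auto simp: h1_def h2_def)
  next
    fix Z W assume "Z \<in> ?T" "W \<in> ?T"
    then have "Z \<in> carrier_mat ?q 1" "W \<in> carrier_mat ?q 1" using T by blast+
    then show "(h1 (Z + W), h2 (Z + W)) = pair_add (h1 Z, h2 Z) (h1 W, h2 W)"
      by (auto simp: pair_add_def h1_def h2_def)
  next
    fix Z and r :: 'r assume "Z \<in> ?T"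
    then have "Z \<in> carrier_mat ?q 1" using T by blast
    then show "(h1 (mat_rscale Z r), h2 (mat_rscale Z r)) = pair_rscale (h1 Z, h2 Z) r"
      by (auto simp: pair_rscale_def mat_rscale_def h1_def h2_def left_diff_distrib)
  qed
  also have "(\<lambda>Z. (h1 Z, h2 Z)) ` ?T = system_solutions act k m n M N"
  proof (intro equalityI subsetI)
    fix w assume "w \<in> (\<lambda>Z. (h1 Z, h2 Z)) ` ?T"
    then obtain Z where Z: "Z \<in> ?T" and w: "w = (h1 Z, h2 Z)" by blast
    have "0\<^sub>m m 1 \<le> h1 Z" using Z by (auto simp: zero_mat_le_iff h1_def)
    then show "w \<in> system_solutions act k m n M N"
      using Z PZ[OF T[OF Z]] h by (simp add: w system_solutions_def)
  next
    fix w assume "w \<in> system_solutions act k m n M N"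
    then obtain X Y where w: "w = (X, Y)" and X: "X \<in> carrier_mat m 1" "0\<^sub>m m 1 \<le> X"
      and Y: "Y \<in> carrier_mat n 1"
      and ge: "0\<^sub>m k 1 \<le> mat_act act M X + mat_act act N Y"
      by (auto simp: system_solutions_def)
    \<comment> \<open>Directedness supplies some decomposition of each element; \<open>a\<close> and
      \<open>b\<close> choose one, as the order gives no canonical positive and negative
      parts.\<close>
    obtain a b :: "'r \<Rightarrow> 'r"
      where ab: "\<And>x. 0 \<le> a x" "\<And>x. 0 \<le> b x" "\<And>x. a x - b x = x"
      using po_directed unfolding add_uminus_conv_diff by metis
    \<comment> \<open>A preimage of \<open>(X, Y)\<close>: \<open>X\<close> on top, then the chosen
      parts of the entries of \<open>Y\<close>.\<close>
    define Z where "Z = mat ?q 1 (\<lambda>(i, _). if i < m then X $$ (i, 0)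
      else if i < m + n then a (Y $$ (i - m, 0)) else b (Y $$ (i - (m + n), 0)))"
    have Z: "Z \<in> carrier_mat ?q 1" "0\<^sub>m ?q 1 \<le> Z"
      using X ab by (auto simp: zero_mat_le_iff Z_def)
    have "h1 Z = X" by (rule eq_matI) (use X in \<open>auto simp: h1_def Z_def\<close>)
    moreover have "h2 Z = Y"
      by (rule eq_matI) (use Y ab(3) in \<open>auto simp: h2_def Z_def\<close>)
    ultimately show "w \<in> (\<lambda>Z. (h1 Z, h2 Z)) ` ?T"
      using ge Z PZ[OF Z(1)] by (auto simp: w intro!: image_eqI[of _ _ Z])
  qed
  finally show ?thesis .
qed

section \<open>From systems back to coherence\<close>

text \<open>A coherence condition is a system with one row and no unrestricted unknowns. The second
  component is then the empty column, and projecting to the first one preserves finite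
  generation.\<close>

lemma po_coherent_if_system_solutions_fin_gen:
  assumes fg: "\<And>n U N. U \<in> carrier_mat 1 n \<Longrightarrow> N \<in> carrier_mat 1 0 \<Longrightarrow>
    fin_gen_right_semimodule pair_add (0\<^sub>m n 1, 0\<^sub>m 0 1) pair_rscale
      (system_solutions act 1 n 0 U N)"
  shows "po_coherent act"
  unfolding po_coherent_def
proof (intro allI impI ballI)
  fix n and U :: "'a mat" assume U: "U \<in> carrier_mat 1 n"
  let ?N = "0\<^sub>m 1 0 :: 'a mat"
  \<comment> \<open>The matrix \<open>?N\<close> has no columns, so its term is an empty sum in the
    single row.\<close>
  have "mat_act act U X + mat_act act ?N Y = mat_act act U X"
    if "X \<in> carrier_mat n 1" "Y \<in> carrier_mat 0 1" for X Y
    by (rule eq_matI) (use U that in \<open>auto simp: mat_act_def\<close>)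
  then have "fst ` system_solutions act 1 n 0 U ?N =
      {X \<in> carrier_mat n 1. 0\<^sub>m 1 1 \<le> mat_act act U X \<and> 0\<^sub>m n 1 \<le> X}"
    by (force simp: system_solutions_def intro!: image_eqI[where x = "(_, 0\<^sub>m 0 1)"])
  moreover have "fin_gen_right_semimodule (+) (0\<^sub>m n 1) mat_rscale
      (fst ` system_solutions act 1 n 0 U ?N)"
    by (rule fin_gen_right_semimodule_image[OF fg[OF U zero_carrier_mat]])
      (auto simp: pair_add_def pair_rscale_def)
  ultimately show "fin_gen_right_semimodule (+) (0\<^sub>m n 1) mat_rscale
      {X \<in> carrier_mat n 1. 0\<^sub>m 1 1 \<le> mat_act act U X \<and> 0\<^sub>m n 1 \<le> X}"
    by simp
qed

end

theorem theorem3p6: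
  fixes act :: "'a::ordered_ab_group_add \<Rightarrow> 'r::po_ring \<Rightarrow> 'a"
  assumes "po_right_module act"
  shows "po_coherent act \<longleftrightarrow>
    (\<forall>k m n. \<forall>M \<in> carrier_mat k m. \<forall>N \<in> carrier_mat k n.
       fin_gen_right_semimodule pair_add (0\<^sub>m m 1, 0\<^sub>m n 1) pair_rscale
         (system_solutions act k m n M N))"
proof -
  interpret po_right_module act by fact
  show ?thesis
    using system_solutions_fin_gen po_coherent_if_system_solutions_fin_gen by blast
qed

end
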